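(* Let $C\in M(3,\mathbb{Z})$, and let $A,B$ be integer $3\times 3$ matrices such that the identity matrix $E$, $A$ and $B$ form a $\mathbb{Z}$-basis of the additive group $\overline{\Xi}(C)$ of all integer $3\times 3$ matrices commuting with $C$. Let $$Q_{A,B}(x,y,z;m,n)=\bar P_{A,B}(m,n)\,\tilde P_{A,A^{\vee}}(x,y,z),$$ which is a polynomial with integer coefficients. Then $C$ is of Frobenius type if and only if the equation $|Q_{A,B}(x,y,z;m,n)|=1$ has a solution in integers $x,y,z,m,n$.
   Context: $M(3,\mathbb{Z})$ denotes the set of $3\times 3$ matrices with integer entries whose characteristic polynomial is irreducible over $\mathbb{Q}$. For integers $a_1,a_2,a_3$, the Frobenius matrix is $$M_{a_1,a_2,a_3}=\begin{pmatrix} 0 & 1 & 0 \\ 0 & 0 & 1 \\ a_3 & a_2 & a_1 \end{pmatrix}.$$ A matrix $C\in M(3,\mathbb{Z})$ is of Frobenius type if there exist integers $a_1,a_2,a_3$ and $X\in SL(3,\mathbb{Z})$ such that $XCX^{-1}$ commutes with $M_{a_1,a_2,a_3}$. The group $\overline{\Xi}(C)$ is isomorphic to $\mathbb{Z}^3$. Definition of $\bar P_{A,B}$: since $B\in\overline{\Xi}(C)$, one has $B=\alpha A^2+\beta A+\gamma E$ with rational $\alpha,\beta,\gamma$. Let the characteristic polynomial of $A$ be $\chi(x)=-x^3+a_1x^2-a_2x+a_3$. Then $$\bar P_{A,B}(m,n)=m^3+(2a_1\alpha+3\beta)m^2n+\big((a_2+a_1^2)\alpha^2+4a_1\alpha\beta+3\beta^2\big)mn^2+\big((a_1a_2-a_3)\alpha^3+(a_2+a_1^2)\alpha^2\beta+2a_1\alpha\beta^2+\beta^3\big)n^3.$$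 Definition of $A^\vee$: $A^\vee$ is the adjugate (classical adjoint) of $A$, so that $AA^\vee=\det(A)E$; its $(i,j)$ entry is $(-1)^{i+j}$ times the minor of $A$ obtained by deleting row $j$ and column $i$. Definition of $\tilde P_{A,D}$: for $3\times 3$ matrices $A=(a_{ij})$, $D=(d_{ij})$ put $\langle ij,kl\rangle=\langle ij,kl\rangle_{A,D}=a_{ij}d_{kl}-a_{kl}d_{ij}$, and $$\begin{aligned}\tilde P_{A,D}(x,y,z)={}&\langle 12,13\rangle x^3+\langle 23,21\rangle y^3+\langle 31,32\rangle z^3\\&+\big(\langle 13,11\rangle+\langle 22,13\rangle+\langle 12,23\rangle\big)x^2y+\big(\langle 22,23\rangle+\langle 23,11\rangle+\langle 13,21\rangle\big)xy^2\\&+\big(\langle 12,33\rangle+\langle 11,12\rangle+\langle 32,13\rangle\big)x^2z+\big(\langle 32,33\rangle+\langle 11,32\rangle+\langle 31,12\rangle\big)xz^2\\&+\big(\langle 21,22\rangle+\langle 33,21\rangle+\langle 23,31\rangle\big)y^2z+\big(\langle 31,22\rangle+\langle 33,31\rangle+\langle 21,32\rangle\big)yz^2\\&+\big(\langle 11,22\rangle+\langle 22,33\rangle+\langle 33,11\rangle+3\langle 13,31\rangle\big)xyz.\end{aligned}$$ *)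

theory Defs
  imports
    "Jordan_Normal_Form.Char_Poly"
    "HOL-Computational_Algebra.Polynomial_Factorial"
begin

definition M3Z :: "int mat set" where
  "M3Z = {C \<in> carrier_mat 3 3. irreducible (char_poly (map_mat rat_of_int C))}"

definition SL3Z :: "int mat set" where
  "SL3Z = {X \<in> carrier_mat 3 3. det X = 1}"

definition frobenius_mat :: "int \<Rightarrow> int \<Rightarrow> int \<Rightarrow> int mat" where
  "frobenius_mat a1 a2 a3 = mat_of_rows_list 3 [[0, 1, 0], [0, 0, 1], [a3, a2, a1]]"

(* Y is the inverse of X; it is automatically an integer matrix because det X = 1. *)
definition frobenius_type :: "int mat \<Rightarrow> bool" where
  "frobenius_type C \<longleftrightarrow> C \<in> M3Z \<and>
     (\<exists>a1 a2 a3. \<exists>X \<in> SL3Z. \<exists>Y \<in> carrier_mat 3 3.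
        inverts_mat X Y \<and> inverts_mat Y X \<and>
        (X * C * Y) * frobenius_mat a1 a2 a3 = frobenius_mat a1 a2 a3 * (X * C * Y))"

definition Xi_bar :: "int mat \<Rightarrow> int mat set" where
  "Xi_bar C = {X \<in> carrier_mat 3 3. X * C = C * X}"

definition Z_basis3 :: "int mat set \<Rightarrow> int mat \<Rightarrow> int mat \<Rightarrow> int mat \<Rightarrow> bool" where
  "Z_basis3 G U V W \<longleftrightarrow> U \<in> G \<and> V \<in> G \<and> W \<in> G \<and>
     (\<forall>X \<in> G. \<exists>p q r. X = p \<cdot>\<^sub>m U + q \<cdot>\<^sub>m V + r \<cdot>\<^sub>m W) \<and>
     (\<forall>p q r. p \<cdot>\<^sub>m U + q \<cdot>\<^sub>m V + r \<cdot>\<^sub>m W = 0\<^sub>m 3 3 \<longrightarrow> p = 0 \<and> q = 0 \<and> r = 0)"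

(* The triple (alpha, beta, gamma) with B = alpha A^2 + beta A + gamma E.  When E, A, B is a
   Z-basis of Xi_bar C with C in M3Z, it exists since the rational matrices commuting with C form
   the cubic field Q(C) = Q(A), and it is unique since E, A, A^2 are independent over Q. *)
definition quad_coeffs :: "int mat \<Rightarrow> int mat \<Rightarrow> rat \<times> rat \<times> rat" where
  "quad_coeffs A B = (THE (\<alpha>, \<beta>, \<gamma>).
     map_mat rat_of_int B =
       \<alpha> \<cdot>\<^sub>m (map_mat rat_of_int A ^\<^sub>m 2) + \<beta> \<cdot>\<^sub>m map_mat rat_of_int A + \<gamma> \<cdot>\<^sub>m 1\<^sub>m 3)"

(* The numbers a1, a2, a3 are taken from det (A - x E) = - x^3 + a1 x^2 - a2 x + a3, whereas
   char_poly A is the monic det (x E - A); this explains the signs. *)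
definition P_bar :: "int mat \<Rightarrow> int mat \<Rightarrow> rat \<Rightarrow> rat \<Rightarrow> rat" where
  "P_bar A B m n =
     (let (\<alpha>, \<beta>, \<gamma>) = quad_coeffs A B;
          a1 = rat_of_int (- coeff (char_poly A) 2);
          a2 = rat_of_int (coeff (char_poly A) 1);
          a3 = rat_of_int (- coeff (char_poly A) 0)
      in m ^ 3
         + (2 * a1 * \<alpha> + 3 * \<beta>) * m ^ 2 * n
         + ((a2 + a1 ^ 2) * \<alpha> ^ 2 + 4 * a1 * \<alpha> * \<beta> + 3 * \<beta> ^ 2) * m * n ^ 2
         + ((a1 * a2 - a3) * \<alpha> ^ 3 + (a2 + a1 ^ 2) * \<alpha> ^ 2 * \<beta> + 2 * a1 * \<alpha> * \<beta> ^ 2 + \<beta> ^ 3)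
             * n ^ 3)"

(* bracket A D i j k l is <ij,kl> with indices running from 1; matrix entries are 0-based. *)
definition bracket :: "int mat \<Rightarrow> int mat \<Rightarrow> nat \<Rightarrow> nat \<Rightarrow> nat \<Rightarrow> nat \<Rightarrow> rat" where
  "bracket A D i j k l =
     rat_of_int (A $$ (i - 1, j - 1) * D $$ (k - 1, l - 1) - A $$ (k - 1, l - 1) * D $$ (i - 1, j - 1))"

definition P_tilde :: "int mat \<Rightarrow> int mat \<Rightarrow> rat \<Rightarrow> rat \<Rightarrow> rat \<Rightarrow> rat" where
  "P_tilde A D x y z =
     (let b = bracket A D in
        b 1 2 1 3 * x ^ 3 + b 2 3 2 1 * y ^ 3 + b 3 1 3 2 * z ^ 3
      + (b 1 3 1 1 + b 2 2 1 3 + b 1 2 2 3) * x ^ 2 * y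
      + (b 2 2 2 3 + b 2 3 1 1 + b 1 3 2 1) * x * y ^ 2
      + (b 1 2 3 3 + b 1 1 1 2 + b 3 2 1 3) * x ^ 2 * z
      + (b 3 2 3 3 + b 1 1 3 2 + b 3 1 1 2) * x * z ^ 2
      + (b 2 1 2 2 + b 3 3 2 1 + b 2 3 3 1) * y ^ 2 * z
      + (b 3 1 2 2 + b 3 3 3 1 + b 2 1 3 2) * y * z ^ 2
      + (b 1 1 2 2 + b 2 2 3 3 + b 3 3 1 1 + 3 * b 1 3 3 1) * x * y * z)"

definition Q_poly ::
  "int mat \<Rightarrow> int mat \<Rightarrow> rat \<Rightarrow> rat \<Rightarrow> rat \<Rightarrow> rat \<Rightarrow> rat \<Rightarrow> rat" where
  "Q_poly A B x y z m n = P_bar A B m n * P_tilde A (adj_mat A) x y z"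

(* A polynomial over the infinite field of rationals is determined by its polynomial function,
   so this says that the polynomial f has integer coefficients (not merely integer values at
   integer points: the identity is required at all rational arguments). *)
definition int_coeff_poly5 :: "(rat \<Rightarrow> rat \<Rightarrow> rat \<Rightarrow> rat \<Rightarrow> rat \<Rightarrow> rat) \<Rightarrow> bool" where
  "int_coeff_poly5 f \<longleftrightarrow>
     (\<exists>(S :: (nat \<times> nat \<times> nat \<times> nat \<times> nat) set) (c :: nat \<times> nat \<times> nat \<times> nat \<times> nat \<Rightarrow> int).
        finite S \<and>
        (\<forall>x y z m n. f x y z m n =
           (\<Sum>(i, j, k, r, s) \<in> S.
              rat_of_int (c (i, j, k, r, s)) * x ^ i * y ^ j * z ^ k * m ^ r * n ^ s)))"

end

theory Submission
  imports Defs
begin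

text \<open>
  A matrix T is conjugate to a Frobenius matrix by an element of SL(3, Z) exactly if some integer
  row v makes the rows v, v T, v T^2 a matrix of determinant 1: they are then the rows of the
  conjugating matrix, by the Cayley--Hamilton theorem. So C is of Frobenius type iff some T in the
  commutant of C admits such a v, and adding a scalar matrix to T does not change the determinant,
  so T = m A + n B suffices. Modulo E, this T is u A + w A^2 with u = m + n \<beta> and w = n \<alpha>;
  reducing T^2 by Cayley--Hamilton shows that passing from A to T multiplies the determinant by
  the cubic form \<open>P_bar\<close>, while det (v, v A, v A^2) is \<open>P_tilde\<close> because the adjugate of A
  is A^2 plus a combination of A and E. Hence the value of Q is det (v, v T, v T^2), and signs do
  not matter since v may be replaced by -v. The polynomial Q is integral because this determinant
  has integer matrices A and B as its only coefficients.

  The coefficients \<alpha>, \<beta>, \<gamma> come from writing A^2 = p E + q A + r B. If r were 0, the matrix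
  A - (tr A - q) E would be singular, commute with C and be nonzero, which contradicts the
  irreducibility of the characteristic polynomial of C.
\<close>

section \<open>Three by three matrices\<close>

lemma mult_mat_entry_3:
  assumes "A \<in> carrier_mat k 3" "B \<in> carrier_mat 3 l" "i < k" "j < l"
  shows "(A * B) $$ (i, j) = A $$ (i, 0) * B $$ (0, j) + A $$ (i, 1) * B $$ (1, j) + A $$ (i, 2) * B $$ (2, j)"
  using assms by (simp add: scalar_prod_def numeral_3_eq_3 numeral_2_eq_2)

lemma det_2:
  assumes "A \<in> carrier_mat 2 2"
  shows "det A = A $$ (0, 0) * A $$ (1, 1) - A $$ (0, 1) * A $$ (1, 0)"
  by (subst laplace_expansion_row[OF assms, of 0])
    (use assms in \<open>auto simp: cofactor_def det_single mat_delete_def numeral_2_eq_2\<close>)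

text \<open>The conditionals pick, in increasing order, the two indices among 0, 1, 2 that survive
  the deletion of \<open>i\<close> or \<open>j\<close>, so that one formula covers all nine
  cofactors.\<close>

lemma cofactor_3:
  assumes "A \<in> carrier_mat 3 3"
  shows "cofactor A i j = (-1) ^ (i + j) *
    (A $$ (if 0 < i then 0 else 1, if 0 < j then 0 else 1) * A $$ (if 1 < i then 1 else 2, if 1 < j then 1 else 2) -
     A $$ (if 0 < i then 0 else 1, if 1 < j then 1 else 2) * A $$ (if 1 < i then 1 else 2, if 0 < j then 0 else 1))"
  using assms mat_delete_carrier[OF assms, of i j]
  by (simp add: cofactor_def det_2 mat_delete_def numeral_2_eq_2)

lemma det_3:
  assumes "A \<in> carrier_mat 3 3"
  shows "det A = A $$ (0, 0) * (A $$ (1, 1) * A $$ (2, 2) - A $$ (1, 2) * A $$ (2, 1))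
    - A $$ (0, 1) * (A $$ (1, 0) * A $$ (2, 2) - A $$ (1, 2) * A $$ (2, 0))
    + A $$ (0, 2) * (A $$ (1, 0) * A $$ (2, 1) - A $$ (1, 1) * A $$ (2, 0))"
  by (subst laplace_expansion_row[OF assms, of 0])
    (simp_all add: cofactor_3[OF assms] numeral_3_eq_3 numeral_2_eq_2 algebra_simps)

lemma eq_mat_3I:
  assumes "A \<in> carrier_mat 3 3" "B \<in> carrier_mat 3 3"
    and "\<And>i j. i \<in> {0, 1, 2} \<Longrightarrow> j \<in> {0, 1, 2} \<Longrightarrow> A $$ (i, j) = B $$ (i, j)"
  shows "A = B"
  using assms by (intro eq_matI) (auto simp: numeral_3_eq_3 numeral_2_eq_2 less_Suc_eq)

section \<open>Characteristic polynomial, Cayley--Hamilton and the adjugate\<close>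

definition trace3 :: "'a :: comm_ring_1 mat \<Rightarrow> 'a" where
  "trace3 A = A $$ (0, 0) + A $$ (1, 1) + A $$ (2, 2)"

text \<open>The second elementary symmetric function of the eigenvalues, that is, the
  \<open>a2\<close> in \<open>P_bar\<close>.\<close>

definition minors3 :: "'a :: comm_ring_1 mat \<Rightarrow> 'a" where
  "minors3 A = A $$ (0, 0) * A $$ (1, 1) - A $$ (0, 1) * A $$ (1, 0)
    + A $$ (0, 0) * A $$ (2, 2) - A $$ (0, 2) * A $$ (2, 0)
    + A $$ (1, 1) * A $$ (2, 2) - A $$ (1, 2) * A $$ (2, 1)"

lemma char_poly_3:
  assumes "A \<in> carrier_mat 3 3"
  shows "char_poly A = [:- det A, minors3 A, - trace3 A, 1:]"
proof -
  have "char_poly_matrix A \<in> carrier_mat 3 3" using assms by simp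
  then show ?thesis
    unfolding char_poly_def
    using assms by (simp add: det_3 char_poly_matrix_def trace3_def minors3_def algebra_simps)
qed

lemma cayley_hamilton_3:
  assumes "A \<in> carrier_mat 3 3"
  shows "A * A * A = trace3 A \<cdot>\<^sub>m (A * A) + (- minors3 A) \<cdot>\<^sub>m A + det A \<cdot>\<^sub>m 1\<^sub>m 3"
  by (rule eq_mat_3I) (use assms in \<open>auto simp: mult_mat_entry_3[where k = 3 and l = 3] trace3_def minors3_def det_3 algebra_simps simp del: index_mult_mat(1)\<close>)

text \<open>This is Cayley--Hamilton with one factor A split off. It shows that the adjugate is a
  polynomial in A and hence commutes with everything that commutes with A.\<close>

lemma adj_mat_3:
  assumes "A \<in> carrier_mat 3 3"
  shows "adj_mat A = A * A + (- trace3 A) \<cdot>\<^sub>m A + minors3 A \<cdot>\<^sub>m 1\<^sub>m 3"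
proof (rule eq_mat_3I)
  show "adj_mat A \<in> carrier_mat 3 3" using assms by (rule adj_mat)
  fix i j :: nat assume "i \<in> {0, 1, 2}" "j \<in> {0, 1, 2}"
  then show "adj_mat A $$ (i, j) = (A * A + (- trace3 A) \<cdot>\<^sub>m A + minors3 A \<cdot>\<^sub>m 1\<^sub>m 3) $$ (i, j)"
    using assms by (auto simp: mult_mat_entry_3[where k = 3 and l = 3] adj_mat_def cofactor_3
        trace3_def minors3_def algebra_simps simp del: index_mult_mat(1))
qed (use assms in auto)

section \<open>Krylov matrices of row vectors\<close>

text \<open>Row vectors are 1 by 3 matrices, so that V T and V T T are ordinary matrix products and
  associativity applies to them.\<close>

definition row3 :: "'a \<Rightarrow> 'a \<Rightarrow> 'a \<Rightarrow> 'a mat" where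
  "row3 x y z = mat 1 3 (\<lambda>(i, j). if j = 0 then x else if j = 1 then y else z)"

definition krylov :: "'a :: semiring_1 mat \<Rightarrow> 'a mat \<Rightarrow> 'a mat" where
  "krylov V T = mat 3 3 (\<lambda>(i, j). (V * T ^\<^sub>m i) $$ (0, j))"

lemma row3_carrier [simp]: "row3 x y z \<in> carrier_mat 1 3"
  by (simp add: row3_def)

lemma row3_index [simp]:
  "row3 x y z $$ (0, 0) = x" "row3 x y z $$ (0, 1) = y" "row3 x y z $$ (0, Suc 0) = y" "row3 x y z $$ (0, 2) = z"
  by (simp_all add: row3_def)

lemma krylov_carrier [simp]: "krylov V T \<in> carrier_mat 3 3"
  by (simp add: krylov_def)

lemma krylov_index:
  assumes "V \<in> carrier_mat 1 3" "T \<in> carrier_mat 3 3" "j < 3"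
  shows "krylov V T $$ (0, j) = V $$ (0, j)" "krylov V T $$ (1, j) = (V * T) $$ (0, j)"
    "krylov V T $$ (2, j) = (V * T * T) $$ (0, j)"
  using assms by (simp_all add: krylov_def numeral_2_eq_2 assoc_mult_mat[of V 1 3 T 3 T 3])

text \<open>Cayley--Hamilton multiplied by V from the left. Taking V or V A as the row reduces V A^3
  and V A^4 to V, V A and V A^2.\<close>

lemma row_cayley_hamilton_3:
  fixes A :: "'a :: comm_ring_1 mat"
  assumes V: "V \<in> carrier_mat 1 3" and A: "A \<in> carrier_mat 3 3" and j: "j < 3"
  shows "(V * A * A * A) $$ (0, j)
    = trace3 A * (V * A * A) $$ (0, j) - minors3 A * (V * A) $$ (0, j) + det A * V $$ (0, j)"
proof -
  have "V * A * A * A = V * (A * A * A)"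
    using V A by (simp add: assoc_mult_mat[of _ _ 3 _ 3 _ 3])
  also have "\<dots> = trace3 A \<cdot>\<^sub>m (V * A * A) + (- minors3 A) \<cdot>\<^sub>m (V * A) + det A \<cdot>\<^sub>m V"
    using V A unfolding cayley_hamilton_3[OF A]
    by (simp add: mult_add_distrib_mat[of V 1 3 _ 3] mult_smult_distrib[of V 1 3 _ 3] assoc_mult_mat[of _ _ 3 _ 3 _ 3])
  finally show ?thesis using V A j by (simp del: index_mult_mat(1))
qed

section \<open>Frobenius matrices in Krylov bases\<close>

lemma frobenius_mat_carrier [simp]: "frobenius_mat a1 a2 a3 \<in> carrier_mat 3 3"
  by (simp add: frobenius_mat_def mat_of_rows_list_def numeral_3_eq_3)

lemma frobenius_mat_index:
  "frobenius_mat a1 a2 a3 $$ (0, 0) = 0" "frobenius_mat a1 a2 a3 $$ (0, 1) = 1"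
  "frobenius_mat a1 a2 a3 $$ (0, 2) = 0" "frobenius_mat a1 a2 a3 $$ (1, 0) = 0"
  "frobenius_mat a1 a2 a3 $$ (1, 1) = 0" "frobenius_mat a1 a2 a3 $$ (1, 2) = 1"
  "frobenius_mat a1 a2 a3 $$ (2, 0) = a3" "frobenius_mat a1 a2 a3 $$ (2, 1) = a2"
  "frobenius_mat a1 a2 a3 $$ (2, 2) = a1"
  by (simp_all add: frobenius_mat_def mat_of_rows_list_def)

text \<open>Multiplication by T moves each of the first two rows to the next one, and
  Cayley--Hamilton rewrites V T^3. Left multiplication by the Frobenius matrix does the same, so an
  invertible \<open>krylov V T\<close> conjugates T to Frobenius form.\<close>

lemma krylov_mult:
  assumes V: "V \<in> carrier_mat 1 3" and T: "T \<in> carrier_mat 3 3"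
  shows "krylov V T * T = frobenius_mat (trace3 T) (- minors3 T) (det T) * krylov V T"
proof (rule eq_mat_3I)
  show F: "frobenius_mat (trace3 T) (- minors3 T) (det T) * krylov V T \<in> carrier_mat 3 3"
    by (rule mult_carrier_mat[of _ 3 3]) simp_all
  fix i j :: nat assume ij: "i \<in> {0, 1, 2}" "j \<in> {0, 1, 2}"
  then have j: "j < 3" by auto
  have c: "V * T \<in> carrier_mat 1 3" "V * T * T \<in> carrier_mat 1 3"
    using mult_carrier_mat[OF V T] mult_carrier_mat[OF mult_carrier_mat[OF V T] T] .
  have "(krylov V T * T) $$ (0, j) = (V * T) $$ (0, j)"
    "(krylov V T * T) $$ (1, j) = (V * T * T) $$ (0, j)"
    "(krylov V T * T) $$ (2, j) = (V * T * T * T) $$ (0, j)"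
    using V T j krylov_index[OF V T]
    by (simp_all add: mult_mat_entry_3[OF krylov_carrier T] mult_mat_entry_3[OF V T] mult_mat_entry_3[OF c(1) T]
        mult_mat_entry_3[OF c(2) T] del: assoc_mult_mat index_mult_mat(1) One_nat_def)
  then show "(krylov V T * T) $$ (i, j) = (frobenius_mat (trace3 T) (- minors3 T) (det T) * krylov V T) $$ (i, j)"
    using ij j krylov_index[OF V T j] row_cayley_hamilton_3[OF V T j]
    by (auto simp: mult_mat_entry_3[OF frobenius_mat_carrier krylov_carrier] frobenius_mat_index simp del: index_mult_mat(1) One_nat_def)
qed (rule mult_carrier_mat[OF krylov_carrier T])

section \<open>Krylov determinants of quadratic polynomials in A\<close>

text \<open>S is L R for a matrix L with first row (1, 0, 0), so det L is the minor formed by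
  \<open>u\<close>, \<open>w\<close>, \<open>u'\<close>, \<open>w'\<close>; the multiples
  \<open>g\<close>, \<open>g'\<close> of the first row drop out.\<close>

lemma det_3_row_combination:
  fixes R S :: "'a :: comm_ring_1 mat"
  assumes "R \<in> carrier_mat 3 3" "S \<in> carrier_mat 3 3"
    and "\<And>j. j < 3 \<Longrightarrow> S $$ (0, j) = R $$ (0, j)"
    and "\<And>j. j < 3 \<Longrightarrow> S $$ (1, j) = g * R $$ (0, j) + u * R $$ (1, j) + w * R $$ (2, j)"
    and "\<And>j. j < 3 \<Longrightarrow> S $$ (2, j) = g' * R $$ (0, j) + u' * R $$ (1, j) + w' * R $$ (2, j)"
  shows "det S = (u * w' - w * u') * det R"
  using assms by (simp add: det_3 algebra_simps del: One_nat_def)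

lemma quadratic_commute:
  fixes A :: "'a :: comm_ring_1 mat"
  assumes A: "A \<in> carrier_mat n n" and C: "C \<in> carrier_mat n n" and comm: "A * C = C * A"
  shows "(w \<cdot>\<^sub>m (A * A) + u \<cdot>\<^sub>m A + g \<cdot>\<^sub>m 1\<^sub>m n) * C = C * (w \<cdot>\<^sub>m (A * A) + u \<cdot>\<^sub>m A + g \<cdot>\<^sub>m 1\<^sub>m n)"
proof -
  have "A * A * C = C * (A * A)"
    using A C comm by (metis assoc_mult_mat)
  then show ?thesis
    using A C comm
    by (simp add: mult_add_distrib_mat[of C n n _ n] mult_smult_distrib[of C n n _ n]
        add_mult_distrib_mat[of _ n n _ C n] mult_smult_assoc_mat[of _ n n C n])
qed

text \<open>The rows V, V S, V S^2 are combinations of V, V A, V A^2, and the factor is the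
  determinant of this change of rows. It does not involve \<open>g\<close>, so adding a scalar
  matrix changes nothing; \<open>P_bar\<close> is this cubic form after a substitution for
  \<open>u\<close> and \<open>w\<close>.\<close>

lemma det_krylov_quadratic:
  fixes A :: "'a :: comm_ring_1 mat"
  assumes V: "V \<in> carrier_mat 1 3" and A: "A \<in> carrier_mat 3 3"
    and S: "S = w \<cdot>\<^sub>m (A * A) + u \<cdot>\<^sub>m A + g \<cdot>\<^sub>m 1\<^sub>m 3"
  shows "det (krylov V S) =
    (u ^ 3 + 2 * trace3 A * u ^ 2 * w + (minors3 A + trace3 A ^ 2) * u * w ^ 2
      + (trace3 A * minors3 A - det A) * w ^ 3) * det (krylov V A)"
proof -
  have Sc: "S \<in> carrier_mat 3 3" using A S by simp
  have row: "(X * S) $$ (0, j) = w * (X * A * A) $$ (0, j) + u * (X * A) $$ (0, j) + g * X $$ (0, j)"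
    if "X \<in> carrier_mat 1 3" "j < 3" for X j
  proof -
    have "X * S = w \<cdot>\<^sub>m (X * A * A) + u \<cdot>\<^sub>m (X * A) + g \<cdot>\<^sub>m X"
      using that A unfolding S
      by (simp add: mult_add_distrib_mat[of X 1 3 _ 3] mult_smult_distrib[of X 1 3 _ 3] assoc_mult_mat[of _ _ 3 _ 3 _ 3])
    then show ?thesis using that A by (simp del: index_mult_mat(1))
  qed
  have "S * A = A * S"
    unfolding S by (rule quadratic_commute[OF A A refl])
  \<comment> \<open>This moves S to the right of A, so that V S S becomes a combination of V A A S,
    V A S and V S, each of which \<open>row\<close> expands.\<close>
  then have comm: "X * S * A = X * A * S" if "X \<in> carrier_mat 1 3" for X
    using that A Sc by (simp add: assoc_mult_mat[of _ 1 3 _ 3 _ 3])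
  show ?thesis
  \<comment> \<open>The last three arguments are the coefficients of S^2 on E, A, A^2. Reducing A^4
    first gives A^3 the coefficient \<open>w * (w * trace3 A + 2 * u)\<close>, and then A^3 is
    reduced.\<close>
  proof (subst det_3_row_combination[of "krylov V A" "krylov V S" g u w
        "g ^ 2 + w * (w * trace3 A + 2 * u) * det A"
        "2 * g * u - w * (w * trace3 A + 2 * u) * minors3 A + w ^ 2 * det A"
        "2 * g * w + u ^ 2 + w * (w * trace3 A + 2 * u) * trace3 A - w ^ 2 * minors3 A"])
    fix j :: nat assume j: "j < 3"
    note K = krylov_index[OF V A j] krylov_index[OF V Sc j]
    show "krylov V S $$ (0, j) = krylov V A $$ (0, j)" using K by simp
    show "krylov V S $$ (1, j) = g * krylov V A $$ (0, j) + u * krylov V A $$ (1, j) + w * krylov V A $$ (2, j)"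
      unfolding K using row[OF V j] by simp
    have c: "V * A \<in> carrier_mat 1 3" "V * A * A \<in> carrier_mat 1 3" "V * S \<in> carrier_mat 1 3" using V A Sc by auto
    show "krylov V S $$ (2, j) = (g ^ 2 + w * (w * trace3 A + 2 * u) * det A) * krylov V A $$ (0, j)
      + (2 * g * u - w * (w * trace3 A + 2 * u) * minors3 A + w ^ 2 * det A) * krylov V A $$ (1, j)
      + (2 * g * w + u ^ 2 + w * (w * trace3 A + 2 * u) * trace3 A - w ^ 2 * minors3 A) * krylov V A $$ (2, j)"
      unfolding K row[OF c(3) j] comm[OF V] comm[OF c(1)] row[OF V j] row[OF c(1) j] row[OF c(2) j]
        row_cayley_hamilton_3[OF V A j] row_cayley_hamilton_3[OF c(1) A j]
      by (simp add: algebra_simps power2_eq_square del: index_mult_mat(1))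
  next
    show "(u * (2 * g * w + u ^ 2 + w * (w * trace3 A + 2 * u) * trace3 A - w ^ 2 * minors3 A)
        - w * (2 * g * u - w * (w * trace3 A + 2 * u) * minors3 A + w ^ 2 * det A)) * det (krylov V A)
      = (u ^ 3 + 2 * trace3 A * u ^ 2 * w + (minors3 A + trace3 A ^ 2) * u * w ^ 2
      + (trace3 A * minors3 A - det A) * w ^ 3) * det (krylov V A)"
      by (simp add: algebra_simps power2_eq_square power3_eq_cube)
  qed simp_all
qed

text \<open>For v = (x, y, z) and D commuting with A, \<open>P_tilde A D\<close> is the determinant
  of the rows v, v A, v D: the term 3<13,31> stands for <13,31> + <21,12> + <32,23>, whose summands
  agree by the diagonal entries of AD = DA. For the adjugate, v D differs from v A^2 by a
  combination of v A and v.\<close>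

lemma P_tilde_adj:
  assumes A: "A \<in> carrier_mat 3 3"
  shows "P_tilde A (adj_mat A) x y z = det (krylov (row3 x y z) (map_mat rat_of_int A))"
proof -
  have A': "map_mat rat_of_int A \<in> carrier_mat 3 3" using A by simp
  note K = krylov_index[OF row3_carrier A', of _ x y z]
  have "row3 x y z * map_mat rat_of_int A \<in> carrier_mat 1 3"
    by (rule mult_carrier_mat[OF row3_carrier A'])
  note K = K mult_mat_entry_3[OF row3_carrier A'] mult_mat_entry_3[OF this A']
  have adj: "adj_mat A $$ (i, j) = cofactor A j i" if "i < 3" "j < 3" for i j
    using A that by (simp add: adj_mat_def)
  show ?thesis
    using A A' unfolding P_tilde_def Let_def bracket_def
    by (simp add: adj cofactor_3[OF A] det_3 K del: index_mult_mat(1) One_nat_def)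
      (simp add: power2_eq_square power3_eq_cube algebra_simps)
qed

section \<open>Singular matrices in the commutant\<close>

lemma irreducible_no_root:
  fixes p :: "'a :: field poly"
  assumes "irreducible p" "degree p > 1"
  shows "poly p a \<noteq> 0"
proof
  assume "poly p a = 0"
  then obtain q where q: "p = [:- a, 1:] * q" by (auto simp: poly_eq_0_iff_dvd dvd_def)
  have "q \<noteq> 0" using q assms by auto
  then have "degree p = 1 + degree q" unfolding q by (subst degree_mult_eq) auto
  moreover have "degree q = 0"
    using irreducibleD[OF assms(1) q] by (auto simp: is_unit_iff_degree \<open>q \<noteq> 0\<close>)
  ultimately show False using assms(2) by simp
qed

text \<open>Up to sign, the entries of the adjugate are the 2 by 2 minors of Y, so Y has rank at
  most 1.\<close>

lemma adj_mat_0_imp_proportional: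
  fixes Y :: "'a :: field mat"
  assumes Y: "Y \<in> carrier_mat 3 3" and co: "adj_mat Y = 0\<^sub>m 3 3"
    and "i < 3" "j < 3" "k < 3" "l < 3"
  shows "Y $$ (i, j) * Y $$ (k, l) = Y $$ (i, l) * Y $$ (k, j)"
proof -
  have "cofactor Y j i = 0" if "i < 3" "j < 3" for i j
    using arg_cong[OF co, of "\<lambda>M. M $$ (i, j)"] that Y by (simp add: adj_mat_def)
  from this[of 0 0] this[of 0 1] this[of 0 2] this[of 1 0] this[of 1 1] this[of 1 2]
    this[of 2 0] this[of 2 1] this[of 2 2] show ?thesis
    using assms(3-) unfolding cofactor_3[OF Y]
    by (auto simp: numeral_3_eq_3 numeral_2_eq_2 less_Suc_eq mult.commute)
qed

text \<open>A nonzero column of Y spans the column space, as Y has rank 1. Since C Y = Y C, the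
  matrix C maps this column into that space, hence to a multiple of itself.\<close>

lemma eigenvalue_of_commuting_rank_1:
  fixes C :: "'a :: field mat"
  assumes C: "C \<in> carrier_mat 3 3" and Y: "Y \<in> carrier_mat 3 3" and comm: "Y * C = C * Y"
    and "Y \<noteq> 0\<^sub>m 3 3" and adj: "adj_mat Y = 0\<^sub>m 3 3"
  shows "\<exists>a. eigenvalue C a"
proof -
  obtain i j where ij: "i < 3" "j < 3" "Y $$ (i, j) \<noteq> 0"
    using assms(2,4) by (metis carrier_matD eq_matI index_zero_mat)
  \<comment> \<open>The factor is read off in row \<open>i\<close>, where column \<open>j\<close> of
    Y does not vanish.\<close>
  define a where "a = (Y * C) $$ (i, j) / Y $$ (i, j)"
  have "eigenvector C (col Y j) a"
    unfolding eigenvector_def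
  proof (intro conjI)
    show "col Y j \<in> carrier_vec (dim_row C)" using C Y ij by (simp add: carrier_vecI)
    have "col Y j $ i \<noteq> 0" using ij Y by simp
    then show "col Y j \<noteq> 0\<^sub>v (dim_row C)" using ij C by auto
    show "C *\<^sub>v col Y j = a \<cdot>\<^sub>v col Y j"
    proof (intro eq_vecI)
      fix k assume "k < dim_vec (a \<cdot>\<^sub>v col Y j)"
      then have k: "k < 3" using Y by simp
      have "(C *\<^sub>v col Y j) $ k = (C * Y) $$ (k, j)" using C Y k ij by simp
      also have "\<dots> = (Y * C) $$ (k, j)" using comm by simp
      also have "\<dots> * Y $$ (i, j) = Y $$ (k, j) * (Y * C) $$ (i, j)"
      proof -
        have "Y $$ (i, j) * Y $$ (k, l) = Y $$ (i, l) * Y $$ (k, j)" if "l < 3" for l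
          using adj_mat_0_imp_proportional[OF Y adj ij(1,2) k that] .
        from this[of 0] this[of 1] this[of 2] show ?thesis
          using k ij mult_mat_entry_3[OF Y C]
          by (simp add: distrib_right distrib_left mult.assoc mult.commute mult.left_commute del: index_mult_mat(1) One_nat_def)
      qed
      finally show "(C *\<^sub>v col Y j) $ k = (a \<cdot>\<^sub>v col Y j) $ k"
        using ij k Y by (simp add: a_def field_simps del: index_mult_mat)
    qed (use C Y in auto)
  qed
  then show ?thesis unfolding eigenvalue_def by blast
qed

text \<open>A polynomial identity in the entries. It is checked entry by entry, without division by
  det Y, because it is applied to a singular Y.\<close>

lemma adj_mat_adj_mat_3:
  fixes Y :: "'a :: comm_ring_1 mat"
  assumes Y: "Y \<in> carrier_mat 3 3"
  shows "adj_mat (adj_mat Y) = det Y \<cdot>\<^sub>m Y"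
proof (rule eq_mat_3I)
  have c: "adj_mat Y \<in> carrier_mat 3 3" using Y by (rule adj_mat)
  then show "adj_mat (adj_mat Y) \<in> carrier_mat 3 3" by (rule adj_mat)
  have adj: "adj_mat Z $$ (i, j) = cofactor Z j i" if "Z \<in> carrier_mat 3 3" "i < 3" "j < 3" for Z :: "'a mat" and i j
    using that by (simp add: adj_mat_def)
  fix i j :: nat assume "i \<in> {0, 1, 2}" "j \<in> {0, 1, 2}"
  then show "adj_mat (adj_mat Y) $$ (i, j) = (det Y \<cdot>\<^sub>m Y) $$ (i, j)"
    using Y c by (auto simp: adj cofactor_3 det_3 algebra_simps)
qed (use Y in simp)

text \<open>Either Y or its adjugate has rank 1, since the adjugate of the adjugate is det Y times Y; and
  the columns of a rank 1 matrix commuting with C are eigenvectors of C.\<close>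
lemma commuting_singular_eq_0:
  fixes C :: "'a :: field mat"
  assumes C: "C \<in> carrier_mat 3 3" and irr: "irreducible (char_poly C)"
    and Y: "Y \<in> carrier_mat 3 3" and comm: "Y * C = C * Y" and det: "det Y = 0"
  shows "Y = 0\<^sub>m 3 3"
proof (rule ccontr)
  assume nz: "Y \<noteq> 0\<^sub>m 3 3"
  have no_ev: "\<not> eigenvalue C a" for a
    using irreducible_no_root[OF irr] degree_monic_char_poly[OF C]
    by (simp add: eigenvalue_root_char_poly[OF C])
  let ?Z = "adj_mat Y"
  have Z: "?Z \<in> carrier_mat 3 3" using Y by (rule adj_mat)
  show False
  proof (cases "?Z = 0\<^sub>m 3 3")
    case True
    then show ?thesis using eigenvalue_of_commuting_rank_1[OF C Y comm nz] no_ev by blast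
  next
    case False
    have one: "1 \<cdot>\<^sub>m M = M" for M :: "'a mat" by (intro eq_matI) auto
    have "?Z * C = C * ?Z"
      using quadratic_commute[OF Y C comm, of 1 "- trace3 Y" "minors3 Y"]
      unfolding adj_mat_3[OF Y] one .
    moreover have "adj_mat ?Z = 0\<^sub>m 3 3"
      unfolding adj_mat_adj_mat_3[OF Y] det using Y by auto
    ultimately show ?thesis using eigenvalue_of_commuting_rank_1[OF C Z] False no_ev by blast
  qed
qed

section \<open>Polynomials with integer coefficients\<close>

text \<open>Treating the exponent tuple as a single index allows sums and products to be formed
  without splitting it.\<close>

definition monom5 :: "nat \<times> nat \<times> nat \<times> nat \<times> nat \<Rightarrow> rat \<Rightarrow> rat \<Rightarrow> rat \<Rightarrow> rat \<Rightarrow> rat \<Rightarrow> rat" where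
  "monom5 t x y z m n = (case t of (i, j, k, r, s) \<Rightarrow> x ^ i * y ^ j * z ^ k * m ^ r * n ^ s)"

lemma int_coeff_poly5_iff:
  "int_coeff_poly5 f \<longleftrightarrow>
    (\<exists>S c. finite S \<and> (\<forall>x y z m n. f x y z m n = (\<Sum>t\<in>S. of_int (c t) * monom5 t x y z m n)))"
proof -
  have "(\<Sum>t\<in>S. of_int (c t) * monom5 t x y z m n) =
      (\<Sum>(i, j, k, r, s) \<in> S. of_int (c (i, j, k, r, s)) * x ^ i * y ^ j * z ^ k * m ^ r * n ^ s)"
    for S c x y z m n
    by (rule sum.cong) (simp_all add: monom5_def mult.assoc split_def)
  then show ?thesis unfolding int_coeff_poly5_def by simp
qed

lemma int_coeff_poly5_monom5: "int_coeff_poly5 (\<lambda>x y z m n. of_int a * monom5 t x y z m n)"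
  unfolding int_coeff_poly5_iff
  by (rule exI[of _ "{t}"], rule exI[of _ "\<lambda>_. a"]) simp

lemma int_coeff_poly5_add:
  assumes "int_coeff_poly5 f" "int_coeff_poly5 g"
  shows "int_coeff_poly5 (\<lambda>x y z m n. f x y z m n + g x y z m n)"
proof -
  from assms(1) obtain S c where S: "finite S"
    and f: "\<forall>x y z m n. f x y z m n = (\<Sum>t\<in>S. of_int (c t) * monom5 t x y z m n)"
    unfolding int_coeff_poly5_iff by (elim exE conjE)
  from assms(2) obtain T d where T: "finite T"
    and g: "\<forall>x y z m n. g x y z m n = (\<Sum>t\<in>T. of_int (d t) * monom5 t x y z m n)"
    unfolding int_coeff_poly5_iff by (elim exE conjE)
  \<comment> \<open>Extending both coefficient families by 0 makes them live on the common support
    \<open>S \<union> T\<close>.\<close>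
  define c' where "c' t = (if t \<in> S then c t else 0)" for t
  define d' where "d' t = (if t \<in> T then d t else 0)" for t
  have "f x y z m n + g x y z m n = (\<Sum>t\<in>S \<union> T. of_int (c' t + d' t) * monom5 t x y z m n)" for x y z m n
  proof -
    have "f x y z m n = (\<Sum>t\<in>S \<union> T. of_int (c' t) * monom5 t x y z m n)"
      unfolding f[rule_format] using S T by (intro sum.mono_neutral_cong_left) (auto simp: c'_def)
    moreover have "g x y z m n = (\<Sum>t\<in>S \<union> T. of_int (d' t) * monom5 t x y z m n)"
      unfolding g[rule_format] using S T by (intro sum.mono_neutral_cong_left) (auto simp: d'_def)
    ultimately show ?thesis by (simp add: sum.distrib distrib_right)
  qed
  moreover have "finite (S \<union> T)" using S T by simp
  ultimately show ?thesis
    unfolding int_coeff_poly5_iff by (intro exI[of _ "S \<union> T"] exI[of _ "\<lambda>t. c' t + d' t"]) simp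
qed

lemma int_coeff_poly5_const: "int_coeff_poly5 (\<lambda>x y z m n. of_int a)"
  using int_coeff_poly5_monom5[of a "(0, 0, 0, 0, 0)"] by (simp add: monom5_def)

lemma int_coeff_poly5_sum:
  assumes "finite I" "\<And>i. i \<in> I \<Longrightarrow> int_coeff_poly5 (f i)"
  shows "int_coeff_poly5 (\<lambda>x y z m n. \<Sum>i\<in>I. f i x y z m n)"
  using assms
proof (induction I rule: finite_induct)
  case empty
  then show ?case using int_coeff_poly5_const[of 0] by simp
next
  case (insert i I)
  have "int_coeff_poly5 (\<lambda>x y z m n. f i x y z m n + (\<Sum>i\<in>I. f i x y z m n))"
    using insert by (intro int_coeff_poly5_add) simp_all
  then show ?case using insert.hyps by simp
qed

text \<open>The product is a double sum of integer multiples of monomials. Equal exponents need not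
  be collected, since closure under finite sums takes care of them.\<close>

lemma int_coeff_poly5_mult:
  assumes "int_coeff_poly5 f" "int_coeff_poly5 g"
  shows "int_coeff_poly5 (\<lambda>x y z m n. f x y z m n * g x y z m n)"
proof -
  from assms(1) obtain S c where S: "finite S"
    and f: "\<forall>x y z m n. f x y z m n = (\<Sum>t\<in>S. of_int (c t) * monom5 t x y z m n)"
    unfolding int_coeff_poly5_iff by (elim exE conjE)
  from assms(2) obtain T d where T: "finite T"
    and g: "\<forall>x y z m n. g x y z m n = (\<Sum>t\<in>T. of_int (d t) * monom5 t x y z m n)"
    unfolding int_coeff_poly5_iff by (elim exE conjE)
  have "int_coeff_poly5 (\<lambda>x y z m n. of_int (c s) * monom5 s x y z m n * (of_int (d t) * monom5 t x y z m n))" for s t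
  proof -
    obtain i j k r l where s: "s = (i, j, k, r, l)" by (metis prod_cases5)
    obtain i' j' k' r' l' where t: "t = (i', j', k', r', l')" by (metis prod_cases5)
    have "of_int (c s) * monom5 s x y z m n * (of_int (d t) * monom5 t x y z m n)
        = of_int (c s * d t) * monom5 (i + i', j + j', k + k', r + r', l + l') x y z m n" for x y z m n
      by (simp add: s t monom5_def power_add)
    then show ?thesis using int_coeff_poly5_monom5 by presburger
  qed
  then have "int_coeff_poly5 (\<lambda>x y z m n. \<Sum>s\<in>S. \<Sum>t\<in>T.
      of_int (c s) * monom5 s x y z m n * (of_int (d t) * monom5 t x y z m n))"
    using S T by (intro int_coeff_poly5_sum)
  then show ?thesis unfolding f[rule_format] g[rule_format] sum_product .
qed

lemma int_coeff_poly5_diff: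
  assumes "int_coeff_poly5 f" "int_coeff_poly5 g"
  shows "int_coeff_poly5 (\<lambda>x y z m n. f x y z m n - g x y z m n)"
  using int_coeff_poly5_add[OF assms(1) int_coeff_poly5_mult[OF int_coeff_poly5_const[of "-1"] assms(2)]] by simp

lemma int_coeff_poly5_var:
  "int_coeff_poly5 (\<lambda>x y z m n. x)" "int_coeff_poly5 (\<lambda>x y z m n. y)" "int_coeff_poly5 (\<lambda>x y z m n. z)"
  "int_coeff_poly5 (\<lambda>x y z m n. m)" "int_coeff_poly5 (\<lambda>x y z m n. n)"
  using int_coeff_poly5_monom5[of 1 "(1, 0, 0, 0, 0)"] int_coeff_poly5_monom5[of 1 "(0, 1, 0, 0, 0)"]
    int_coeff_poly5_monom5[of 1 "(0, 0, 1, 0, 0)"] int_coeff_poly5_monom5[of 1 "(0, 0, 0, 1, 0)"]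
    int_coeff_poly5_monom5[of 1 "(0, 0, 0, 0, 1)"]
  by (simp_all add: monom5_def)

text \<open>The entries of m A + n B are linear forms in m, n with integer coefficients, and the
  determinant arises from them and x, y, z by ring operations only.\<close>

lemma int_coeff_poly5_det_krylov:
  assumes A: "A \<in> carrier_mat 3 3" and B: "B \<in> carrier_mat 3 3"
  shows "int_coeff_poly5 (\<lambda>x y z m n.
    det (krylov (row3 x y z) (m \<cdot>\<^sub>m map_mat rat_of_int A + n \<cdot>\<^sub>m map_mat rat_of_int B)))"
proof -
  define T where "T m n = m \<cdot>\<^sub>m map_mat rat_of_int A + n \<cdot>\<^sub>m map_mat rat_of_int B" for m n
  have T: "T m n \<in> carrier_mat 3 3" for m n using A B by (simp add: T_def)
  have V: "row3 x y z * T m n \<in> carrier_mat 1 3" for x y z m n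
    by (rule mult_carrier_mat[OF row3_carrier T])
  have "T m n $$ (i, j) = m * of_int (A $$ (i, j)) + n * of_int (B $$ (i, j))" if "i < 3" "j < 3" for m n i j
    using A B that by (simp add: T_def)
  then have ix: "int_coeff_poly5 (\<lambda>x y z m n. T m n $$ (i, j))" if "i < 3" "j < 3" for i j
    using that by (simp del: One_nat_def)
      (intro int_coeff_poly5_add int_coeff_poly5_mult int_coeff_poly5_var int_coeff_poly5_const)
  \<comment> \<open>The row W is arbitrary so that the step can be iterated: first for v, then for v
    T.\<close>
  have row: "int_coeff_poly5 (\<lambda>x y z m n. (W x y z m n * T m n) $$ (0, j))"
    if "\<And>x y z m n. W x y z m n \<in> carrier_mat 1 3" "j < 3"
      "\<And>i. i < 3 \<Longrightarrow> int_coeff_poly5 (\<lambda>x y z m n. W x y z m n $$ (0, i))" for W j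
  proof -
    have "(W x y z m n * T m n) $$ (0, j) = W x y z m n $$ (0, 0) * T m n $$ (0, j)
        + W x y z m n $$ (0, 1) * T m n $$ (1, j) + W x y z m n $$ (0, 2) * T m n $$ (2, j)" for x y z m n
      using that by (intro mult_mat_entry_3[OF that(1) T]) auto
    then show ?thesis
      by simp (intro int_coeff_poly5_add int_coeff_poly5_mult ix that; simp)
  qed
  have 0: "int_coeff_poly5 (\<lambda>x y z m n. row3 x y z $$ (0, j))" if "j < 3" for j
  proof -
    have "j = 0 \<or> j = 1 \<or> j = 2" using that by auto
    then show ?thesis using int_coeff_poly5_var by (elim disjE) simp_all
  qed
  note 1 = row[OF row3_carrier _ 0]
  note 2 = row[OF V _ 1]
  have K: "int_coeff_poly5 (\<lambda>x y z m n. krylov (row3 x y z) (T m n) $$ (i, j))"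
    if "i \<in> {0, 1, 2}" "j < 3" for i j
    using that 0 1 2
    by (auto simp: krylov_index[OF row3_carrier T] simp del: assoc_mult_mat index_mult_mat(1) One_nat_def row3_index)
  show ?thesis
    unfolding T_def[symmetric] det_3[OF krylov_carrier]
    by (intro int_coeff_poly5_add int_coeff_poly5_diff int_coeff_poly5_mult K) simp_all
qed

section \<open>A basis of the commutant\<close>

lemma ex_common_denominator:
  fixes p q r :: rat
  shows "\<exists>d a b c. d \<noteq> 0 \<and> p * of_int d = of_int a \<and> q * of_int d = of_int b \<and> r * of_int d = of_int c"
proof -
  obtain a k b l c m where
    "p = of_int a / of_int k" "q = of_int b / of_int l" "r = of_int c / of_int m" "k \<noteq> 0" "l \<noteq> 0" "m \<noteq> 0"
    by (metis Fract_of_int_quotient Rat_cases less_irrefl)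
  then show ?thesis
    by (intro exI[of _ "k * l * m"] exI[of _ "a * l * m"] exI[of _ "b * k * m"] exI[of _ "c * k * l"]) simp
qed

lemma det_add_scalar_3:
  fixes A :: "'a :: comm_ring_1 mat"
  assumes "A \<in> carrier_mat 3 3"
  shows "det (A + s \<cdot>\<^sub>m 1\<^sub>m 3) = s ^ 3 + trace3 A * s ^ 2 + minors3 A * s + det A"
  using assms by (simp add: det_3 trace3_def minors3_def power2_eq_square power3_eq_cube algebra_simps)

lemma of_int_mat_hom_3:
  "A \<in> carrier_mat 3 3 \<Longrightarrow> trace3 (map_mat rat_of_int A) = of_int (trace3 A)"
  "A \<in> carrier_mat 3 3 \<Longrightarrow> minors3 (map_mat rat_of_int A) = of_int (minors3 A)"
  "det (map_mat rat_of_int A) = of_int (det A)"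
  by (simp_all add: trace3_def minors3_def of_int_hom.hom_det)

locale Xi_basis =
  fixes C A B :: "int mat"
  assumes C: "C \<in> M3Z" and A: "A \<in> carrier_mat 3 3" and B: "B \<in> carrier_mat 3 3"
    and basis: "Z_basis3 (Xi_bar C) (1\<^sub>m 3) A B"
begin

lemma C_carrier: "C \<in> carrier_mat 3 3"
  using C by (simp add: M3Z_def)

lemma commute: "A * C = C * A" "B * C = C * B"
  using basis by (auto simp: Z_basis3_def Xi_bar_def)

lemma independent:
  "p \<cdot>\<^sub>m 1\<^sub>m 3 + q \<cdot>\<^sub>m A + r \<cdot>\<^sub>m B = 0\<^sub>m 3 3 \<Longrightarrow> p = 0 \<and> q = 0 \<and> r = 0"
  using basis by (simp add: Z_basis3_def)

lemma spanning:
  assumes "X \<in> carrier_mat 3 3" "X * C = C * X"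
  obtains p q r where "X = p \<cdot>\<^sub>m 1\<^sub>m 3 + q \<cdot>\<^sub>m A + r \<cdot>\<^sub>m B"
  using basis assms by (auto simp: Z_basis3_def Xi_bar_def)

text \<open>Passing to the rationals makes the irreducibility of the characteristic polynomial of C
  available.\<close>

lemma singular_eq_0:
  assumes X: "X \<in> carrier_mat 3 3" and comm: "X * C = C * X" and det: "det X = 0"
  shows "X = 0\<^sub>m 3 3"
proof -
  let ?f = "map_mat rat_of_int"
  have "?f X * ?f C = ?f C * ?f X"
    using of_int_hom.mat_hom_mult[OF X C_carrier] of_int_hom.mat_hom_mult[OF C_carrier X] comm by metis
  then have "?f X = 0\<^sub>m 3 3"
    using C X det by (intro commuting_singular_eq_0[of "?f C"]) (auto simp: M3Z_def of_int_hom.hom_det)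
  then have "?f X $$ (i, j) = 0" if "i < 3" "j < 3" for i j using that by simp
  then show ?thesis using X by (intro eq_matI) auto
qed

lemma square_in_span:
  obtains p q r where "A * A = p \<cdot>\<^sub>m 1\<^sub>m 3 + q \<cdot>\<^sub>m A + r \<cdot>\<^sub>m B" "r \<noteq> 0"
proof -
  have "A * A * C = C * (A * A)"
    using A C_carrier commute by (metis assoc_mult_mat)
  then obtain p q r where AA: "A * A = p \<cdot>\<^sub>m 1\<^sub>m 3 + q \<cdot>\<^sub>m A + r \<cdot>\<^sub>m B"
    using spanning[of "A * A"] A by auto
  have "r \<noteq> 0"
  proof
    assume "r = 0"
    then have AA': "A * A = p \<cdot>\<^sub>m 1\<^sub>m 3 + q \<cdot>\<^sub>m A" unfolding AA using A B by (intro eq_matI) auto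
    let ?t = "trace3 A" and ?m = "minors3 A"
    have "(p \<cdot>\<^sub>m 1\<^sub>m 3 + q \<cdot>\<^sub>m A) * A = p \<cdot>\<^sub>m A + q \<cdot>\<^sub>m (A * A)"
      using A by (simp add: add_mult_distrib_mat[of _ 3 3 _ A 3] mult_smult_assoc_mat[of _ 3 3 A 3])
    \<comment> \<open>Two expressions for A^3: A times the relation for A^2, and
      Cayley--Hamilton.\<close>
    then have ch: "p \<cdot>\<^sub>m A + q \<cdot>\<^sub>m (p \<cdot>\<^sub>m 1\<^sub>m 3 + q \<cdot>\<^sub>m A)
        = ?t \<cdot>\<^sub>m (p \<cdot>\<^sub>m 1\<^sub>m 3 + q \<cdot>\<^sub>m A) + (- ?m) \<cdot>\<^sub>m A + det A \<cdot>\<^sub>m 1\<^sub>m 3"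
      using cayley_hamilton_3[OF A] unfolding AA' by simp
    have ij: "p * A $$ (i, j) + q * (p * 1\<^sub>m 3 $$ (i, j) + q * A $$ (i, j))
        = ?t * (p * 1\<^sub>m 3 $$ (i, j) + q * A $$ (i, j)) - ?m * A $$ (i, j) + det A * 1\<^sub>m 3 $$ (i, j)"
      if "i < 3" "j < 3" for i j
      using arg_cong[OF ch, of "\<lambda>M. M $$ (i, j)"] A that by (simp del: index_one_mat(1))
    have "(q * p - ?t * p - det A) \<cdot>\<^sub>m 1\<^sub>m 3 + (p + q * q - ?t * q + ?m) \<cdot>\<^sub>m A + 0 \<cdot>\<^sub>m B = 0\<^sub>m 3 3"
    proof (intro eq_matI)
      fix i j assume "i < dim_row (0\<^sub>m 3 3 :: int mat)" "j < dim_col (0\<^sub>m 3 3 :: int mat)"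
      then show "((q * p - ?t * p - det A) \<cdot>\<^sub>m 1\<^sub>m 3 + (p + q * q - ?t * q + ?m) \<cdot>\<^sub>m A + 0 \<cdot>\<^sub>m B) $$ (i, j) = 0\<^sub>m 3 3 $$ (i, j)"
        using A B ij[of i j] by (simp add: algebra_simps del: index_one_mat(1))
    qed (use A B in auto)
    then have co: "q * p - ?t * p - det A = 0" "p + q * q - ?t * q + ?m = 0"
      using independent by blast+
    \<comment> \<open>With t the trace, the characteristic polynomial of A is now (x^2 - q x - p)(x
      - (t - q)), so t - q is an eigenvalue and \<open>?X\<close> is singular.\<close>
    let ?s = "q - ?t"
    let ?X = "A + ?s \<cdot>\<^sub>m 1\<^sub>m 3"
    have m: "?m = ?t * q - p - q * q" and d: "det A = q * p - ?t * p" using co by linarith+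
    have "det ?X = 0"
      unfolding det_add_scalar_3[OF A] m d by (simp add: algebra_simps power2_eq_square power3_eq_cube)
    moreover have "?X * C = C * ?X"
      using A C_carrier commute
      by (simp add: mult_add_distrib_mat[of C 3 3 _ 3] mult_smult_distrib[of C 3 3 _ 3]
          add_mult_distrib_mat[of _ 3 3 _ C 3] mult_smult_assoc_mat[of _ 3 3 C 3])
    ultimately have X: "?X = 0\<^sub>m 3 3" using A by (intro singular_eq_0) auto
    have "?s \<cdot>\<^sub>m 1\<^sub>m 3 + 1 \<cdot>\<^sub>m A + 0 \<cdot>\<^sub>m B = ?X" using A B by (intro eq_matI) auto
    then show False using X independent[of ?s 1 0] by simp
  qed
  then show thesis using AA that by blast
qed

section \<open>The rational coefficients of B and the value of Q\<close>

text \<open>Clearing denominators reduces this to independence over the integers.\<close>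

lemma rat_independent:
  assumes "p \<cdot>\<^sub>m 1\<^sub>m 3 + q \<cdot>\<^sub>m map_mat rat_of_int A + r \<cdot>\<^sub>m map_mat rat_of_int B = 0\<^sub>m 3 3"
  shows "p = 0 \<and> q = 0 \<and> r = 0"
proof -
  obtain d a b c where d: "d \<noteq> 0" "p * of_int d = of_int a" "q * of_int d = of_int b" "r * of_int d = of_int c"
    using ex_common_denominator[of p q r] by blast
  have "a \<cdot>\<^sub>m 1\<^sub>m 3 + b \<cdot>\<^sub>m A + c \<cdot>\<^sub>m B = 0\<^sub>m 3 3"
  proof (intro eq_matI)
    fix i j assume "i < dim_row (0\<^sub>m 3 3 :: int mat)" "j < dim_col (0\<^sub>m 3 3 :: int mat)"
    then have ij: "i < 3" "j < 3" by auto
    have "p * 1\<^sub>m 3 $$ (i, j) + q * of_int (A $$ (i, j)) + r * of_int (B $$ (i, j)) = 0"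
      using arg_cong[OF assms, of "\<lambda>M. M $$ (i, j)"] ij A B by simp
    then have "(p * 1\<^sub>m 3 $$ (i, j) + q * of_int (A $$ (i, j)) + r * of_int (B $$ (i, j))) * of_int d = 0" by simp
    then have "(p * of_int d) * 1\<^sub>m 3 $$ (i, j) + (q * of_int d) * of_int (A $$ (i, j)) + (r * of_int d) * of_int (B $$ (i, j)) = 0"
      by (simp add: algebra_simps del: mult_eq_0_iff index_one_mat(1))
    moreover have "1\<^sub>m 3 $$ (i, j) = rat_of_int (1\<^sub>m 3 $$ (i, j))" using ij by simp
    ultimately have "rat_of_int (a * 1\<^sub>m 3 $$ (i, j) + b * A $$ (i, j) + c * B $$ (i, j)) = 0"
      unfolding d by simp
    then have "a * 1\<^sub>m 3 $$ (i, j) + b * A $$ (i, j) + c * B $$ (i, j) = 0"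
      using of_int_eq_0_iff by blast
    then show "(a \<cdot>\<^sub>m 1\<^sub>m 3 + b \<cdot>\<^sub>m A + c \<cdot>\<^sub>m B) $$ (i, j) = 0\<^sub>m 3 3 $$ (i, j)"
      using ij A B by (simp del: index_one_mat(1))
  qed (use A B in auto)
  then show ?thesis using independent[of a b c] d by auto
qed

text \<open>Solving A^2 = p E + q A + r B for B gives existence, as r is nonzero. Substituting the
  same relation into any other representation of B leaves a relation between E, A, B, which must be
  trivial.\<close>

lemma quad_coeffs:
  obtains \<alpha> \<beta> \<gamma> where "quad_coeffs A B = (\<alpha>, \<beta>, \<gamma>)"
    "map_mat rat_of_int B = \<alpha> \<cdot>\<^sub>m (map_mat rat_of_int A * map_mat rat_of_int A)
      + \<beta> \<cdot>\<^sub>m map_mat rat_of_int A + \<gamma> \<cdot>\<^sub>m 1\<^sub>m 3"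
proof -
  let ?A = "map_mat rat_of_int A" and ?B = "map_mat rat_of_int B"
  have A': "?A \<in> carrier_mat 3 3" and B': "?B \<in> carrier_mat 3 3" using A B by auto
  have pow: "?A ^\<^sub>m 2 = ?A * ?A" using A' by (simp add: numeral_2_eq_2)
  obtain p q r where AA: "A * A = p \<cdot>\<^sub>m 1\<^sub>m 3 + q \<cdot>\<^sub>m A + r \<cdot>\<^sub>m B" and r: "r \<noteq> 0"
    by (rule square_in_span)
  have sq: "(?A * ?A) $$ (i, j) = of_int p * 1\<^sub>m 3 $$ (i, j) + of_int q * ?A $$ (i, j) + of_int r * ?B $$ (i, j)"
    if "i < 3" "j < 3" for i j
  proof -
    have "(?A * ?A) $$ (i, j) = map_mat rat_of_int (A * A) $$ (i, j)"
      using of_int_hom.mat_hom_mult[OF A A, where ?'a = rat] by simp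
    also have "\<dots> = of_int p * of_int (1\<^sub>m 3 $$ (i, j)) + of_int q * ?A $$ (i, j) + of_int r * ?B $$ (i, j)"
      unfolding AA using A B that by (simp del: index_one_mat(1))
    also have "rat_of_int (1\<^sub>m 3 $$ (i, j)) = 1\<^sub>m 3 $$ (i, j)" using that by simp
    finally show ?thesis .
  qed
  let ?\<alpha> = "1 / rat_of_int r" and ?\<beta> = "- rat_of_int q / of_int r" and ?\<gamma> = "- rat_of_int p / of_int r"
  have ex: "?B = ?\<alpha> \<cdot>\<^sub>m (?A * ?A) + ?\<beta> \<cdot>\<^sub>m ?A + ?\<gamma> \<cdot>\<^sub>m 1\<^sub>m 3"
  proof (intro eq_matI)
    fix i j assume "i < dim_row (?\<alpha> \<cdot>\<^sub>m (?A * ?A) + ?\<beta> \<cdot>\<^sub>m ?A + ?\<gamma> \<cdot>\<^sub>m 1\<^sub>m 3)" "j < dim_col (?\<alpha> \<cdot>\<^sub>m (?A * ?A) + ?\<beta> \<cdot>\<^sub>m ?A + ?\<gamma> \<cdot>\<^sub>m 1\<^sub>m 3)"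
    then have ij: "i < 3" "j < 3" using A by auto
    have "(?\<alpha> \<cdot>\<^sub>m (?A * ?A) + ?\<beta> \<cdot>\<^sub>m ?A + ?\<gamma> \<cdot>\<^sub>m 1\<^sub>m 3) $$ (i, j)
        = ?\<alpha> * (?A * ?A) $$ (i, j) + ?\<beta> * ?A $$ (i, j) + ?\<gamma> * 1\<^sub>m 3 $$ (i, j)"
      using ij A' by (simp del: index_one_mat(1) index_mult_mat(1) index_map_mat)
    also have "\<dots> = ?B $$ (i, j)"
      unfolding sq[OF ij] using r by (simp add: field_simps del: index_one_mat(1) index_map_mat)
    finally show "?B $$ (i, j) = (?\<alpha> \<cdot>\<^sub>m (?A * ?A) + ?\<beta> \<cdot>\<^sub>m ?A + ?\<gamma> \<cdot>\<^sub>m 1\<^sub>m 3) $$ (i, j)" ..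
  qed (use A B in auto)
  have uniq: "a = ?\<alpha> \<and> b = ?\<beta> \<and> c = ?\<gamma>"
    if eq: "?B = a \<cdot>\<^sub>m (?A * ?A) + b \<cdot>\<^sub>m ?A + c \<cdot>\<^sub>m 1\<^sub>m 3" for a b c
  proof -
    have "(a * of_int p + c) \<cdot>\<^sub>m 1\<^sub>m 3 + (a * of_int q + b) \<cdot>\<^sub>m ?A + (a * of_int r - 1) \<cdot>\<^sub>m ?B = 0\<^sub>m 3 3"
    proof (intro eq_matI)
      fix i j assume "i < dim_row (0\<^sub>m 3 3 :: rat mat)" "j < dim_col (0\<^sub>m 3 3 :: rat mat)"
      then have ij: "i < 3" "j < 3" by auto
      have "?B $$ (i, j) = a * (?A * ?A) $$ (i, j) + b * ?A $$ (i, j) + c * 1\<^sub>m 3 $$ (i, j)"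
        using arg_cong[OF eq, of "\<lambda>M. M $$ (i, j)"] ij A' by (simp del: index_one_mat(1) index_mult_mat(1) index_map_mat)
      then show "((a * of_int p + c) \<cdot>\<^sub>m 1\<^sub>m 3 + (a * of_int q + b) \<cdot>\<^sub>m ?A + (a * of_int r - 1) \<cdot>\<^sub>m ?B) $$ (i, j) = 0\<^sub>m 3 3 $$ (i, j)"
        unfolding sq[OF ij] using ij A' B' by (simp add: algebra_simps del: index_one_mat(1) index_map_mat)
    qed (use A B in auto)
    then have "a * of_int p + c = 0" "a * of_int q + b = 0" "a * of_int r - 1 = 0"
      using rat_independent by blast+
    moreover from this r have "a = ?\<alpha>" by (simp add: field_simps)
    ultimately show ?thesis using r by (simp add: field_simps)
  qed
  have "quad_coeffs A B = (?\<alpha>, ?\<beta>, ?\<gamma>)"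
    unfolding quad_coeffs_def pow
  proof (rule the_equality, unfold prod.case)
    fix t
    assume t: "case t of (\<alpha>, \<beta>, \<gamma>) \<Rightarrow> ?B = \<alpha> \<cdot>\<^sub>m (?A * ?A) + \<beta> \<cdot>\<^sub>m ?A + \<gamma> \<cdot>\<^sub>m 1\<^sub>m 3"
    obtain a b c where abc: "t = (a, b, c)" by (rule prod_cases3)
    show "t = (?\<alpha>, ?\<beta>, ?\<gamma>)"
      using uniq[OF t[unfolded abc prod.case]] unfolding abc by simp
  qed (rule ex)
  then show thesis using ex by (rule that)
qed

text \<open>Modulo E, the matrix m A + n B is w A^2 + u A with u = m + n \<beta> and w = n \<alpha>,
  and \<open>P_bar\<close> is the cubic form of \<open>det_krylov_quadratic\<close> expanded in m
  and n. All arguments are rational, as the integrality of the coefficients requires.\<close>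

lemma Q_poly_eq_det_krylov:
  "Q_poly A B x y z m n =
    det (krylov (row3 x y z) (m \<cdot>\<^sub>m map_mat rat_of_int A + n \<cdot>\<^sub>m map_mat rat_of_int B))"
proof -
  let ?A = "map_mat rat_of_int A" and ?B = "map_mat rat_of_int B"
  have A': "?A \<in> carrier_mat 3 3" using A by auto
  obtain \<alpha> \<beta> \<gamma> where qc: "quad_coeffs A B = (\<alpha>, \<beta>, \<gamma>)"
    and B': "?B = \<alpha> \<cdot>\<^sub>m (?A * ?A) + \<beta> \<cdot>\<^sub>m ?A + \<gamma> \<cdot>\<^sub>m 1\<^sub>m 3"
    by (rule quad_coeffs)
  have AA: "?A * ?A \<in> carrier_mat 3 3" using A' by simp
  have S: "m \<cdot>\<^sub>m ?A + n \<cdot>\<^sub>m ?B = (n * \<alpha>) \<cdot>\<^sub>m (?A * ?A) + (m + n * \<beta>) \<cdot>\<^sub>m ?A + (n * \<gamma>) \<cdot>\<^sub>m 1\<^sub>m 3"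
    unfolding B'
  proof (rule eq_mat_3I)
    fix i j :: nat
    assume "i \<in> {0, 1, 2}" "j \<in> {0, 1, 2}"
    then have "i < 3" "j < 3" by auto
    then show "(m \<cdot>\<^sub>m ?A + n \<cdot>\<^sub>m (\<alpha> \<cdot>\<^sub>m (?A * ?A) + \<beta> \<cdot>\<^sub>m ?A + \<gamma> \<cdot>\<^sub>m 1\<^sub>m 3)) $$ (i, j)
      = ((n * \<alpha>) \<cdot>\<^sub>m (?A * ?A) + (m + n * \<beta>) \<cdot>\<^sub>m ?A + (n * \<gamma>) \<cdot>\<^sub>m 1\<^sub>m 3) $$ (i, j)"
      using A' AA by (simp add: distrib_left distrib_right mult.assoc
          del: index_mult_mat(1) index_one_mat(1) index_map_mat(1))
  qed (use A' AA in simp_all)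
  have "coeff (char_poly A) 2 = - trace3 A" "coeff (char_poly A) 1 = minors3 A"
    "coeff (char_poly A) 0 = - det A"
    unfolding char_poly_3[OF A] by (simp_all add: numeral_2_eq_2)
  then have "P_bar A B m n = (m + n * \<beta>) ^ 3 + 2 * trace3 ?A * (m + n * \<beta>) ^ 2 * (n * \<alpha>)
      + (minors3 ?A + trace3 ?A ^ 2) * (m + n * \<beta>) * (n * \<alpha>) ^ 2
      + (trace3 ?A * minors3 ?A - det ?A) * (n * \<alpha>) ^ 3"
    unfolding P_bar_def qc of_int_mat_hom_3(1,2)[OF A] of_int_mat_hom_3(3)
    by (simp only: Let_def prod.case of_int_minus minus_minus)
      (simp add: power2_eq_square power3_eq_cube algebra_simps)
  then show ?thesis
    unfolding Q_poly_def P_tilde_adj[OF A] det_krylov_quadratic[OF row3_carrier A' S] by simp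
qed

end

section \<open>Frobenius type\<close>

lemma map_mat_krylov:
  assumes V: "V \<in> carrier_mat 1 3" and T: "T \<in> carrier_mat 3 3"
  shows "krylov (map_mat rat_of_int V) (map_mat rat_of_int T) = map_mat rat_of_int (krylov V T)"
proof (rule eq_mat_3I)
  let ?f = "map_mat rat_of_int"
  have V': "?f V \<in> carrier_mat 1 3" and T': "?f T \<in> carrier_mat 3 3" and VT: "V * T \<in> carrier_mat 1 3"
    using V T mult_carrier_mat[OF V T] by auto
  have hom: "?f V * ?f T = ?f (V * T)" "?f (V * T) * ?f T = ?f (V * T * T)"
    using of_int_hom.mat_hom_mult[OF V T] of_int_hom.mat_hom_mult[OF VT T] by metis+
  fix i j :: nat assume "i \<in> {0, 1, 2}" "j \<in> {0, 1, 2}"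
  then have i: "i = 0 \<or> i = 1 \<or> i = 2" and j: "j < 3" by auto
  have "?f (krylov V T) $$ (i, j) = of_int (krylov V T $$ (i, j))"
    using i j carrier_matD[OF krylov_carrier, of V T] by auto
  moreover have "?f V $$ (0, j) = of_int (V $$ (0, j))" "?f (V * T) $$ (0, j) = of_int ((V * T) $$ (0, j))"
    "?f (V * T * T) $$ (0, j) = of_int ((V * T * T) $$ (0, j))"
    using V VT T j by (simp_all del: index_mult_mat(1))
  ultimately show "krylov (?f V) (?f T) $$ (i, j) = ?f (krylov V T) $$ (i, j)"
    using i krylov_index[OF V' T' j] krylov_index[OF V T j] unfolding hom by metis
qed simp_all

text \<open>All three rows are linear in v, so negating v gives the sign (-1)^3.\<close>

lemma det_krylov_uminus:
  fixes T :: "'a :: comm_ring_1 mat"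
  assumes T: "T \<in> carrier_mat 3 3"
  shows "det (krylov (row3 (- x) (- y) (- z)) T) = - det (krylov (row3 x y z) T)"
proof -
  have V: "row3 x y z * T \<in> carrier_mat 1 3" for x y z :: 'a
    by (rule mult_carrier_mat[OF row3_carrier T])
  have 1: "(row3 (- x) (- y) (- z) * T) $$ (0, j) = - (row3 x y z * T) $$ (0, j)" if "j < 3" for j
    using that by (simp add: mult_mat_entry_3[OF row3_carrier T] del: index_mult_mat(1) One_nat_def)
  have 2: "(row3 (- x) (- y) (- z) * T * T) $$ (0, j) = - (row3 x y z * T * T) $$ (0, j)" if "j < 3" for j
    using that 1 by (simp add: mult_mat_entry_3[OF V T] del: index_mult_mat(1) assoc_mult_mat One_nat_def)
  show ?thesis
    unfolding det_3[OF krylov_carrier]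
    by (simp add: krylov_index[OF row3_carrier T] 1 2 del: index_mult_mat(1) assoc_mult_mat One_nat_def)
qed

text \<open>A converse to \<open>krylov_mult\<close>: the first two rows of the relation say that T
  maps each row of X to the next, so the first row of X generates the others.\<close>

lemma krylov_of_companion_similarity:
  assumes X: "X \<in> carrier_mat 3 3" and T: "T \<in> carrier_mat 3 3"
    and XT: "X * T = frobenius_mat a1 a2 a3 * X"
  shows "krylov (row3 (X $$ (0, 0)) (X $$ (0, 1)) (X $$ (0, 2))) T = X"
proof (rule eq_mat_3I)
  let ?V = "row3 (X $$ (0, 0)) (X $$ (0, 1)) (X $$ (0, 2))"
  have V: "?V * T \<in> carrier_mat 1 3" by (rule mult_carrier_mat[OF row3_carrier T])
  have 0: "?V $$ (0, j) = X $$ (0, j)" if "j < 3" for j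
  proof -
    have "j = 0 \<or> j = 1 \<or> j = 2" using that by auto
    then show ?thesis by auto
  qed
  have shift: "(X * T) $$ (0, j) = X $$ (1, j)" "(X * T) $$ (1, j) = X $$ (2, j)" if "j < 3" for j
    unfolding XT using that by (simp_all add: mult_mat_entry_3[OF frobenius_mat_carrier X] frobenius_mat_index
        del: index_mult_mat(1) One_nat_def)
  have 1: "(?V * T) $$ (0, j) = X $$ (1, j)" if "j < 3" for j
    using that shift(1) 0 by (simp add: mult_mat_entry_3[OF row3_carrier T] mult_mat_entry_3[OF X T]
        del: index_mult_mat(1) One_nat_def)
  have 2: "(?V * T * T) $$ (0, j) = X $$ (2, j)" if "j < 3" for j
    using that shift(2) 1 by (simp add: mult_mat_entry_3[OF V T] mult_mat_entry_3[OF X T]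
        del: index_mult_mat(1) assoc_mult_mat One_nat_def)
  fix i j :: nat assume "i \<in> {0, 1, 2}" "j \<in> {0, 1, 2}"
  then have i: "i = 0 \<or> i = 1 \<or> i = 2" and j: "j < 3" by auto
  then show "krylov ?V T $$ (i, j) = X $$ (i, j)"
    using krylov_index[OF row3_carrier T j] 0[OF j] 1[OF j] 2[OF j] by metis
qed (use X in simp_all)

context Xi_basis
begin

lemma Q_poly_of_int:
  "Q_poly A B (of_int x) (of_int y) (of_int z) (of_int m) (of_int n)
    = of_int (det (krylov (row3 x y z) (m \<cdot>\<^sub>m A + n \<cdot>\<^sub>m B)))"
proof -
  have "of_int m \<cdot>\<^sub>m map_mat rat_of_int A + of_int n \<cdot>\<^sub>m map_mat rat_of_int B = map_mat rat_of_int (m \<cdot>\<^sub>m A + n \<cdot>\<^sub>m B)"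
    using A B by (intro eq_matI) auto
  moreover have "row3 (of_int x) (of_int y) (of_int z) = map_mat rat_of_int (row3 x y z)"
    by (intro eq_matI) (auto simp: row3_def)
  moreover have S: "m \<cdot>\<^sub>m A + n \<cdot>\<^sub>m B \<in> carrier_mat 3 3" using A B by simp
  ultimately show ?thesis
    by (simp add: Q_poly_eq_det_krylov map_mat_krylov[OF row3_carrier S] of_int_mat_hom_3(3))
qed

text \<open>With X = \<open>krylov V T\<close> one has X T X^-1 = M for a Frobenius matrix M, and
  conjugating TC = CT by X makes X C X^-1 commute with M.\<close>

lemma frobenius_type_if_det_krylov_1:
  assumes T: "T \<in> carrier_mat 3 3" and TC: "T * C = C * T"
    and V: "V \<in> carrier_mat 1 3" and det: "det (krylov V T) = 1"
  shows "frobenius_type C"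
proof -
  define X where "X = krylov V T"
  \<comment> \<open>As det X = 1, the adjugate is the inverse and it is integral.\<close>
  define Y where "Y = adj_mat X"
  define M where "M = frobenius_mat (trace3 T) (- minors3 T) (det T)"
  have X: "X \<in> carrier_mat 3 3" and M: "M \<in> carrier_mat 3 3" by (simp_all add: X_def M_def)
  have Y: "Y \<in> carrier_mat 3 3" unfolding Y_def using X by (rule adj_mat)
  have one: "1 \<cdot>\<^sub>m N = N" for N :: "int mat" by (intro eq_matI) auto
  have XY: "X * Y = 1\<^sub>m 3" and YX: "Y * X = 1\<^sub>m 3"
    unfolding Y_def using adj_mat(2,3)[OF X] det one by (simp_all add: X_def)
  have XT: "X * T = M * X" unfolding X_def M_def by (rule krylov_mult[OF V T])
  note carr = X Y M T C_carrier mult_carrier_mat[of _ 3 3 _ 3]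
  note assoc = assoc_mult_mat[of _ 3 3 _ 3 _ 3]
  have "Y * M = Y * (M * X) * Y" using carr by (simp add: assoc XY)
  also have "\<dots> = (Y * X) * T * Y" unfolding XT[symmetric] using carr by (simp add: assoc)
  finally have YM: "Y * M = T * Y" using carr by (simp add: YX)
  have "(X * C * Y) * M = X * (C * (T * Y))" using carr by (simp add: assoc YM)
  also have "\<dots> = X * (T * C) * Y" unfolding TC using carr by (simp add: assoc)
  also have "\<dots> = (X * T) * (C * Y)" using carr by (simp add: assoc)
  also have "\<dots> = M * (X * C * Y)" unfolding XT using carr by (simp add: assoc)
  finally have "(X * C * Y) * M = M * (X * C * Y)" .
  moreover have "X \<in> SL3Z" using X det by (simp add: SL3Z_def X_def)
  moreover have "inverts_mat X Y" "inverts_mat Y X"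
    using X Y XY YX by (simp_all add: inverts_mat_def)
  ultimately show ?thesis using C Y unfolding frobenius_type_def M_def by blast
qed

text \<open>Conjugating back, T = X^-1 M X commutes with C, and X is the Krylov matrix of T for its
  own first row.\<close>

lemma frobenius_type_imp_det_krylov_1:
  assumes "frobenius_type C"
  obtains T x y z where "T \<in> carrier_mat 3 3" "T * C = C * T" "det (krylov (row3 x y z) T) = 1"
proof -
  obtain a1 a2 a3 X Y where X: "X \<in> carrier_mat 3 3" "det X = 1" and Y: "Y \<in> carrier_mat 3 3"
    and inv: "inverts_mat X Y" "inverts_mat Y X"
    and comm: "(X * C * Y) * frobenius_mat a1 a2 a3 = frobenius_mat a1 a2 a3 * (X * C * Y)"
    using assms by (auto simp: frobenius_type_def SL3Z_def)
  define M where "M = frobenius_mat a1 a2 a3"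
  define T where "T = Y * M * X"
  have M: "M \<in> carrier_mat 3 3" by (simp add: M_def)
  have XY: "X * Y = 1\<^sub>m 3" and YX: "Y * X = 1\<^sub>m 3" using inv X Y by (auto simp: inverts_mat_def)
  note carr = X(1) Y M C_carrier mult_carrier_mat[of _ 3 3 _ 3]
  note assoc = assoc_mult_mat[of _ 3 3 _ 3 _ 3]
  have T: "T \<in> carrier_mat 3 3" unfolding T_def using carr by simp
  have "T * C = Y * (M * (X * C * Y)) * X" unfolding T_def using carr by (simp add: assoc YX)
  also have "\<dots> = (Y * X) * (C * (Y * M * X))"
    unfolding comm[folded M_def, symmetric] using carr by (simp add: assoc)
  also have "\<dots> = C * T" unfolding YX T_def using carr by simp
  finally have TC: "T * C = C * T" .
  have "X * T = (X * Y) * (M * X)" unfolding T_def using carr by (simp add: assoc)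
  then have "X * T = frobenius_mat a1 a2 a3 * X" unfolding XY M_def left_mult_one_mat[OF mult_carrier_mat[OF frobenius_mat_carrier X(1)]] .
  from krylov_of_companion_similarity[OF X(1) T this] T TC X(2) show thesis
    using that by metis
qed

end

theorem theorem3:
  fixes C A B :: "int mat"
  assumes "C \<in> M3Z"
    and "A \<in> carrier_mat 3 3" and "B \<in> carrier_mat 3 3"
    and "Z_basis3 (Xi_bar C) (1\<^sub>m 3) A B"
  shows "int_coeff_poly5 (Q_poly A B) \<and>
    (frobenius_type C \<longleftrightarrow>
      (\<exists>x y z m n :: int.
         \<bar>Q_poly A B (of_int x) (of_int y) (of_int z) (of_int m) (of_int n)\<bar> = 1))"
proof (intro conjI iffI)
  interpret Xi_basis C A B by unfold_locales (use assms in auto)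
  note C = C_carrier
  show "int_coeff_poly5 (Q_poly A B)"
    using int_coeff_poly5_det_krylov[OF A B] unfolding Q_poly_eq_det_krylov[symmetric] by simp
  show "\<exists>x y z m n. \<bar>Q_poly A B (of_int x) (of_int y) (of_int z) (of_int m) (of_int n)\<bar> = 1"
    if frob: "frobenius_type C"
  proof -
    obtain T x y z where T: "T \<in> carrier_mat 3 3" "T * C = C * T" "det (krylov (row3 x y z) T) = 1"
      using frobenius_type_imp_det_krylov_1[OF frob] .
    obtain p m n where pmn: "T = p \<cdot>\<^sub>m 1\<^sub>m 3 + m \<cdot>\<^sub>m A + n \<cdot>\<^sub>m B"
      using spanning[OF T(1,2)] .
    let ?S = "m \<cdot>\<^sub>m A + n \<cdot>\<^sub>m B"
    have S: "?S \<in> carrier_mat 3 3" using A B by simp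
    \<comment> \<open>The case w = 0, u = 1 of \<open>det_krylov_quadratic\<close>: removing the
      scalar part \<open>p\<close> of T preserves the determinant.\<close>
    have "T = 0 \<cdot>\<^sub>m (?S * ?S) + 1 \<cdot>\<^sub>m ?S + p \<cdot>\<^sub>m 1\<^sub>m 3"
      unfolding pmn using A B by (intro eq_matI) (auto simp del: index_mult_mat(1))
    from det_krylov_quadratic[OF row3_carrier S this] T(3)
    have "det (krylov (row3 x y z) ?S) = 1" by simp
    then have "\<bar>Q_poly A B (of_int x) (of_int y) (of_int z) (of_int m) (of_int n)\<bar> = 1"
      by (simp add: Q_poly_of_int)
    then show ?thesis by blast
  qed
  show "frobenius_type C"
    if "\<exists>x y z m n. \<bar>Q_poly A B (of_int x) (of_int y) (of_int z) (of_int m) (of_int n)\<bar> = 1"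
  proof -
    obtain x y z m n where
      "\<bar>Q_poly A B (of_int x) (of_int y) (of_int z) (of_int m) (of_int n)\<bar> = 1" using \<open>Ex _\<close> by blast
    moreover define T where "T = m \<cdot>\<^sub>m A + n \<cdot>\<^sub>m B"
    ultimately have "\<bar>rat_of_int (det (krylov (row3 x y z) T))\<bar> = 1"
      by (simp add: Q_poly_of_int)
    then have det: "\<bar>det (krylov (row3 x y z) T)\<bar> = 1"
      by linarith
    have T: "T \<in> carrier_mat 3 3" using A B by (simp add: T_def)
    have TC: "T * C = C * T"
      unfolding T_def using A B C commute
      by (simp add: mult_add_distrib_mat[of C 3 3 _ 3] mult_smult_distrib[of C 3 3 _ 3]
          add_mult_distrib_mat[of _ 3 3 _ C 3] mult_smult_assoc_mat[of _ 3 3 C 3])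
    \<comment> \<open>A determinant of -1 is turned into 1 by replacing v with -v.\<close>
    consider "det (krylov (row3 x y z) T) = 1" | "det (krylov (row3 (- x) (- y) (- z)) T) = 1"
      using det det_krylov_uminus[OF T, of x y z] by linarith
    then show ?thesis
      using frobenius_type_if_det_krylov_1[OF T TC row3_carrier] by cases
  qed
qed

end
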